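(* Let $g:\mathbb{D}\to\mathbb{C}$ be a totally real univalent function, i.e. $g$ is analytic and injective on $\mathbb{D}$ and in its Taylor expansion $g(z)=\sum a_nz^n$ about $0$ all the $a_n$ are real, and suppose that $a_1>0$. Suppose that $g$ has finite radial limits at $-1$ and $1$, say $\lim_{z\to-1}g(z)=a$ and $\lim_{z\to1}g(z)=b$. Let $\Gamma$ be the circular arc of points $w\in\mathbb{D}$ such that $\arg\left((w-1)/(w+1)\right)=3\pi/4$. Then $g(\Gamma)$ is a curve of Euclidean length at most $\frac{\pi}{2}(b-a)$, with equality if and only if $g(\mathbb{D})=\mathbb{C}\setminus\left((-\infty,a]\cup[b,\infty)\right)$.
   Context: $\mathbb{D}$ is the open unit disc. The limits at $\pm1$ are radial limits, i.e. taken along the real diameter $(-1,1)$. The argument is the principal one, so $\Gamma$ lies in the upper half of $\mathbb{D}$ and joins $-1$ to $1$. *)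

theory Defs
  imports "HOL-Complex_Analysis.Complex_Analysis"
begin

definition totally_real_univalent :: "(complex \<Rightarrow> complex) \<Rightarrow> bool" where
  "totally_real_univalent g \<longleftrightarrow>
     g holomorphic_on ball 0 1 \<and> inj_on g (ball 0 1) \<and>
     (\<forall>n. (deriv ^^ n) g 0 / fact n \<in> \<real>)"

definition Gamma_arc :: "complex set" where
  "Gamma_arc = {w \<in> ball 0 1. Arg ((w - 1) / (w + 1)) = 3 * pi / 4}"

(* Supremum of the lengths of the polygons inscribed in \<gamma> with vertices at
   increasing parameters in I; it may be infinite. For lists with at most one entry
   the sum is empty. *)
definition curve_length :: "real set \<Rightarrow> (real \<Rightarrow> complex) \<Rightarrow> ereal" where
  "curve_length I \<gamma> =
     (SUP ts \<in> {ts. sorted ts \<and> set ts \<subseteq> I}.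
        ereal (\<Sum>i < length ts - 1. dist (\<gamma> (ts ! i)) (\<gamma> (ts ! Suc i))))"

(* The curves considered here are arcs without endpoints, so parametrizations are
   over an open interval. *)
definition open_arc_param :: "(real \<Rightarrow> complex) \<Rightarrow> complex set \<Rightarrow> bool" where
  "open_arc_param \<gamma> C \<longleftrightarrow> (\<exists>\<gamma>'. homeomorphism {0<..<1} C \<gamma> \<gamma>')"

end

theory Submission
  imports Defs "HOL-Real_Asymp.Real_Asymp"
begin

text \<open>Map the disc to the strip \<open>\<bar>Im z\<bar> < pi / 2\<close> so that the real diameter becomes the real
line and \<open>\<Gamma>\<close> becomes the line \<open>Im z = pi / 4\<close>; let \<open>h\<close> be \<open>g\<close> in this coordinate. A univalent
function that is real on the real line and increasing there maps the upper half strip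
\<open>0 < Im z < pi / 2\<close> into the upper half-plane (\<open>Im_h_pos\<close>). The line \<open>Im z = pi / 4\<close> is the
centre line of that half strip, where the hyperbolic density equals \<open>2\<close>, so the
Schwarz-Pick inequality reads \<open>\<bar>h'\<bar> \<le> 2 Im h\<close> there (\<open>speed_le\<close>). Hence the length of the image
curve is at most twice the integral of \<open>Im h\<close> along the line.

That integral can be computed. If \<open>P\<close> is a primitive of \<open>h\<close>, it is the total increase of \<open>Im P\<close>
along the line. On the real axis \<open>Im P\<close> is constant, and on the vertical segment from \<open>x\<close> to
\<open>x + i pi / 4\<close> it increases by the integral of \<open>Re h\<close>, which tends to \<open>b pi / 4\<close> as \<open>x\<close> tends
to \<open>\<infinity>\<close> and to \<open>a pi / 4\<close> as \<open>x\<close> tends to \<open>-\<infinity>\<close> (\<open>flux_potential\<close>). So the integral is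
\<open>(b - a) pi / 4\<close>, and the bound follows. The last step needs \<open>h\<close> to converge uniformly on vertical
segments, although only radial limits are given: since \<open>h\<close> avoids \<open>[b, \<infinity>)\<close>, a square root of
\<open>b - h\<close> has positive real part, and the Schwarz lemma bounds \<open>\<bar>b - h\<bar>\<close> on such a segment by
nine times its value at the foot on the real axis (\<open>norm_le_9_if_slit\<close>).

By the equality case of the Schwarz lemma, \<open>\<bar>h'\<bar> = 2 Im h\<close> at one point of the line if and only if
it holds at all of them, if and only if \<open>h\<close> maps the upper half strip onto the upper half-plane
(\<open>speed_eq_iff\<close>). By reflection this says that the image of \<open>h\<close> is the doubly slit plane
(\<open>onto_upper_iff_slit\<close>), and \<open>curve_length_line\<close> turns it into equality of lengths.\<close>

section \<open>Length of curves\<close>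

definition polygon_length :: "(real \<Rightarrow> complex) \<Rightarrow> real list \<Rightarrow> real" where
  "polygon_length \<gamma> ts = (\<Sum>i < length ts - 1. dist (\<gamma> (ts ! i)) (\<gamma> (ts ! Suc i)))"

lemma polygon_length_simps [simp]:
  "polygon_length \<gamma> [] = 0"
  "polygon_length \<gamma> [s] = 0"
  "polygon_length \<gamma> (s # t # ts) = dist (\<gamma> s) (\<gamma> t) + polygon_length \<gamma> (t # ts)"
  by (simp_all add: polygon_length_def sum.lessThan_Suc_shift del: sum.lessThan_Suc)

lemma polygon_length_append:
  "polygon_length \<gamma> (us @ t # vs) = polygon_length \<gamma> (us @ [t]) + polygon_length \<gamma> (t # vs)"
proof (induction us)
  case (Cons u us)
  then show ?case by (cases us) auto
qed simp

lemma polygon_length_rev: "polygon_length \<gamma> (rev ts) = polygon_length \<gamma> ts"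
proof (induction ts)
  case (Cons s ts)
  then show ?case
    by (cases ts) (auto simp: polygon_length_append[of _ _ _ "[s]"] dist_commute)
qed simp

lemma polygon_length_map: "polygon_length \<gamma> (map \<psi> ts) = polygon_length (\<gamma> \<circ> \<psi>) ts"
  by (induction ts rule: induct_list012) auto

lemma curve_length_alt:
  "curve_length I \<gamma> = (SUP ts \<in> {ts. sorted ts \<and> set ts \<subseteq> I}. ereal (polygon_length \<gamma> ts))"
  unfolding curve_length_def polygon_length_def ..

lemma curve_length_reparam_le:
  assumes mono: "strict_mono_on I \<psi> \<or> strict_antimono_on I \<psi>" and sub: "\<psi> ` I \<subseteq> J"
    and eq: "\<And>t. t \<in> I \<Longrightarrow> \<gamma> t = c (\<psi> t)"
  shows "curve_length I \<gamma> \<le> curve_length J c"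
  unfolding curve_length_alt[of I]
proof (rule SUP_least)
  fix ts assume "ts \<in> {ts. sorted ts \<and> set ts \<subseteq> I}"
  then have ts: "sorted ts" "set ts \<subseteq> I" by auto
  have "polygon_length \<gamma> ts = polygon_length (c \<circ> \<psi>) ts"
    using ts(2) by (induction ts rule: induct_list012) (auto simp: eq)
  also have "\<dots> = polygon_length c (map \<psi> ts)" by (simp add: polygon_length_map)
  finally have len: "polygon_length \<gamma> ts = polygon_length c (map \<psi> ts)"
    "polygon_length \<gamma> ts = polygon_length c (rev (map \<psi> ts))"
    by (simp_all only: polygon_length_rev)
  have "\<exists>us. sorted us \<and> set us \<subseteq> J \<and> polygon_length \<gamma> ts = polygon_length c us"
  proof (cases "strict_mono_on I \<psi>")
    case True
    have "sorted (map \<psi> ts)"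
      using ts by (induction ts) (auto simp: strict_mono_on_leD[OF True])
    with len sub ts show ?thesis
      by (intro exI[of _ "map \<psi> ts"]) auto
  next
    case False
    with mono have anti: "strict_antimono_on I \<psi>" by auto
    then have "\<psi> y \<le> \<psi> x" if "x \<in> I" "y \<in> I" "x \<le> y" for x y
      using that by (cases "x = y") (force simp: monotone_on_def)+
    then have "sorted (rev (map \<psi> ts))"
      using ts by (induction ts) (auto simp: sorted_append)
    with len sub ts show ?thesis
      by (intro exI[of _ "rev (map \<psi> ts)"]) auto
  qed
  then show "ereal (polygon_length \<gamma> ts) \<le> curve_length J c"
    unfolding curve_length_alt by (auto intro: SUP_upper)
qed

text \<open>The transition map between two parametrizations of an arc is a continuous injection of one
interval into another, hence monotone, and a monotone change of parameter carries inscribed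
polygons to inscribed polygons, possibly traversed backwards.\<close>

lemma curve_length_homeomorphism:
  fixes \<gamma> c :: "real \<Rightarrow> complex"
  assumes I: "is_interval I" and J: "is_interval J"
    and \<gamma>: "homeomorphism I C \<gamma> \<gamma>'" and c: "homeomorphism J C c c'"
  shows "curve_length I \<gamma> = curve_length J c"
proof -
  have le: "curve_length I \<gamma> \<le> curve_length J c"
    if I: "is_interval I" and \<gamma>: "homeomorphism I C \<gamma> \<gamma>'" and c: "homeomorphism J C c c'"
    for I J \<gamma> \<gamma>' c c'
  proof (rule curve_length_reparam_le)
    have h: "homeomorphism I J (c' \<circ> \<gamma>) (\<gamma>' \<circ> c)"
      using homeomorphism_compose[OF \<gamma> homeomorphism_symD[OF c]] by simp
    have "inj_on (c' \<circ> \<gamma>) I"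
      using h by (metis homeomorphism_apply1 inj_on_inverseI)
    then show "strict_mono_on I (c' \<circ> \<gamma>) \<or> strict_antimono_on I (c' \<circ> \<gamma>)"
      using injective_eq_monotone_map[OF I homeomorphism_cont1[OF h]] by simp
    show "(c' \<circ> \<gamma>) ` I \<subseteq> J"
      using homeomorphism_image1[OF h] by simp
    show "\<gamma> t = c ((c' \<circ> \<gamma>) t)" if "t \<in> I" for t
      using that homeomorphism_image1[OF \<gamma>] homeomorphism_apply2[OF c] by auto
  qed
  show ?thesis
    using le[OF I \<gamma> c] le[OF J c \<gamma>] by (rule antisym)
qed

lemma polygon_length_le:
  assumes "\<And>s t. s \<le> t \<Longrightarrow> dist (c s) (c t) \<le> \<phi> t - \<phi> s" and "sorted (s # ts)"
  shows "polygon_length c (s # ts) \<le> \<phi> (last (s # ts)) - \<phi> s"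
  using assms(2)
proof (induction ts arbitrary: s)
  case (Cons t ts)
  have "polygon_length c (t # ts) \<le> \<phi> (last (t # ts)) - \<phi> t"
    using Cons by auto
  moreover have "dist (c s) (c t) \<le> \<phi> t - \<phi> s" using Cons.prems assms(1) by auto
  ultimately show ?case by auto
qed simp

text \<open>The increment \<open>\<phi> t - \<phi> s\<close> dominates chords by the mean value inequality, and increments
telescope along a polygon. The bound \<open>B\<close> on increments is separate from \<open>\<phi>\<close> so that \<open>\<phi>\<close> need
not be given limits at infinity.\<close>

lemma curve_length_le:
  fixes c :: "real \<Rightarrow> complex"
  assumes c: "\<And>x. (c has_vector_derivative c' x) (at x)"
    and \<phi>: "\<And>x. (\<phi> has_real_derivative \<phi>' x) (at x)"
    and le: "\<And>x. norm (c' x) \<le> \<phi>' x"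
    and B: "\<And>s t. s \<le> t \<Longrightarrow> \<phi> t - \<phi> s \<le> B"
  shows "curve_length UNIV c \<le> ereal B"
  unfolding curve_length_alt
proof (rule SUP_least)
  fix ts :: "real list" assume "ts \<in> {ts. sorted ts \<and> set ts \<subseteq> UNIV}"
  then have ts: "sorted ts" by auto
  have d: "dist (c s) (c t) \<le> \<phi> t - \<phi> s" if "s \<le> t" for s t
  proof (cases "s = t")
    case False
    have "norm (c t - c s) \<le> \<phi> t - \<phi> s"
    proof (rule differentiable_bound_general)
      show "s < t" using that False by simp
      show "continuous_on {s..t} c"
        by (meson c continuous_at_imp_continuous_on has_vector_derivative_continuous)
      show "continuous_on {s..t} \<phi>"
        by (meson \<phi> DERIV_isCont continuous_at_imp_continuous_on)
      show "(\<phi> has_vector_derivative \<phi>' x) (at x)" for x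
        using \<phi> by (simp add: has_real_derivative_iff_has_vector_derivative)
    qed (use c le in auto)
    then show ?thesis by (simp add: dist_norm norm_minus_commute)
  qed simp
  show "ereal (polygon_length c ts) \<le> ereal B"
  proof (cases ts)
    case Nil
    then show ?thesis using B[of 0 0] by simp
  next
    case (Cons s us)
    then have "polygon_length c ts \<le> \<phi> (last ts) - \<phi> s"
      using polygon_length_le[of c \<phi> s us, OF d] ts by simp
    moreover have "s \<le> last ts"
      using ts Cons by (cases us) auto
    ultimately show ?thesis using B[of s "last ts"] by simp
  qed
qed

text \<open>When \<open>\<phi>'\<close> is the speed itself, short chords straddling a point \<open>x\<close> are as long as the increment
of \<open>\<phi>\<close> up to \<open>\<epsilon>\<close> times the length of the parameter interval, because both are governed by the
derivatives at \<open>x\<close>. Bisection glues such chords to a polygon from \<open>s\<close> to \<open>t\<close>.\<close>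

lemma curve_length_ge:
  fixes c :: "real \<Rightarrow> complex"
  assumes c: "\<And>x. (c has_vector_derivative c' x) (at x)"
    and \<phi>: "\<And>x. (\<phi> has_real_derivative norm (c' x)) (at x)"
    and st: "s \<le> t"
  shows "ereal (\<phi> t - \<phi> s) \<le> curve_length UNIV c"
proof (rule ereal_le_epsilon2)
  fix e :: real assume "e > 0"
  \<comment> \<open>The summand \<open>1\<close> only keeps the quotient meaningful when \<open>s = t\<close>.\<close>
  define \<epsilon> where "\<epsilon> = e / (1 + t - s)"
  have \<epsilon>: "\<epsilon> > 0" using \<open>e > 0\<close> st by (simp add: \<epsilon>_def)
  define P where "P u v \<longleftrightarrow> u \<le> v \<longrightarrow> (\<exists>us. sorted (u # us @ [v]) \<and>
      \<phi> v - \<phi> u - \<epsilon> * (v - u) \<le> polygon_length c (u # us @ [v]))" for u v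
  have "P s t"
    using st
  proof (induction rule: Bolzano)
    case (trans u v w)
    then obtain us vs where sorted: "sorted (u # us @ [v])" "sorted (v # vs @ [w])"
      and le: "\<phi> v - \<phi> u - \<epsilon> * (v - u) \<le> polygon_length c (u # us @ [v])"
        "\<phi> w - \<phi> v - \<epsilon> * (w - v) \<le> polygon_length c (v # vs @ [w])"
      by (auto simp: P_def)
    have "x \<le> y" if "x \<in> set us" "y \<in> set vs" for x y
      using sorted that order_trans[of x v y] by (simp add: sorted_append)
    with sorted trans(3,4) have "sorted (u # (us @ v # vs) @ [w])"
      by (auto simp: sorted_append)
    moreover have "polygon_length c (u # (us @ v # vs) @ [w])
        = polygon_length c (u # us @ [v]) + polygon_length c (v # vs @ [w])"
      using polygon_length_append[of c "u # us" v "vs @ [w]"] by simp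
    moreover have "\<phi> w - \<phi> u - \<epsilon> * (w - u)
        \<le> polygon_length c (u # us @ [v]) + polygon_length c (v # vs @ [w])"
      using le by (simp add: algebra_simps)
    ultimately show ?case
      unfolding P_def by (intro impI exI[of _ "us @ v # vs"] conjI) simp_all
  next
    case (local x)
    have "(c has_derivative (\<lambda>h. h *\<^sub>R c' x)) (at x)"
      "(\<phi> has_derivative (\<lambda>h. norm (c' x) * h)) (at x)"
      using c[of x] \<phi>[of x] by (auto simp: has_vector_derivative_def has_field_derivative_def)
    then have "\<forall>e>0. \<exists>d>0. \<forall>y. norm (y - x) < d \<longrightarrow>
          norm (c y - c x - (y - x) *\<^sub>R c' x) \<le> e * norm (y - x)"
      "\<forall>e>0. \<exists>d>0. \<forall>y. norm (y - x) < d \<longrightarrow>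
          norm (\<phi> y - \<phi> x - norm (c' x) * (y - x)) \<le> e * norm (y - x)"
      unfolding has_derivative_at_alt by simp_all
    from this[rule_format, OF half_gt_zero[OF \<epsilon>]] obtain d1 d2 where d: "d1 > 0" "d2 > 0"
      and d1: "\<And>y. norm (y - x) < d1 \<Longrightarrow>
          norm (c y - c x - (y - x) *\<^sub>R c' x) \<le> \<epsilon>/2 * norm (y - x)"
      and d2: "\<And>y. norm (y - x) < d2 \<Longrightarrow>
          norm (\<phi> y - \<phi> x - norm (c' x) * (y - x)) \<le> \<epsilon>/2 * norm (y - x)"
      by blast
    have "P u v" if uv: "u \<le> x" "x \<le> v" "v - u < min d1 d2" for u v
    proof -
      define A B where "A = c v - c x - (v - x) *\<^sub>R c' x" and "B = c u - c x - (u - x) *\<^sub>R c' x"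
      have eq: "(v - u) *\<^sub>R c' x = (c v - c u) - A + B"
        by (simp add: A_def B_def algebra_simps)
      have "norm ((v - u) *\<^sub>R c' x) \<le> norm (c v - c u) + norm A + norm B"
        unfolding eq using norm_triangle_ineq[of "(c v - c u) - A" B] norm_triangle_ineq4[of "c v - c u" A]
        by linarith
      then have "(v - u) * norm (c' x) \<le> norm (c v - c u) + norm A + norm B"
        using uv by simp
      moreover have "norm A \<le> \<epsilon>/2 * (v - x)"
        using d1[of v] uv by (simp add: A_def)
      moreover have "norm B \<le> \<epsilon>/2 * (x - u)"
        using d1[of u] uv by (simp add: B_def)
      moreover have "\<bar>\<phi> v - \<phi> x - norm (c' x) * (v - x)\<bar> \<le> \<epsilon>/2 * (v - x)"
        using d2[of v] uv by simp
      moreover have "\<bar>\<phi> u - \<phi> x - norm (c' x) * (u - x)\<bar> \<le> \<epsilon>/2 * (x - u)"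
        using d2[of u] uv by simp
      ultimately have "\<phi> v - \<phi> u - \<epsilon> * (v - u) \<le> dist (c u) (c v)"
        unfolding dist_norm norm_minus_commute[of "c u"] abs_le_iff by (simp add: algebra_simps)
      then show ?thesis
        unfolding P_def by (intro impI exI[of _ "[]"]) auto
    qed
    with d show ?case by (intro exI[of _ "min d1 d2"]) auto
  qed
  then obtain us where us: "sorted (s # us @ [t])"
      "\<phi> t - \<phi> s - \<epsilon> * (t - s) \<le> polygon_length c (s # us @ [t])"
    using st by (auto simp: P_def)
  have "\<epsilon> * (t - s) \<le> e"
    using st \<open>e > 0\<close> by (simp add: \<epsilon>_def field_simps)
  then have "ereal (\<phi> t - \<phi> s) \<le> ereal (polygon_length c (s # us @ [t])) + ereal e"
    using us by simp
  also have "ereal (polygon_length c (s # us @ [t])) \<le> curve_length UNIV c"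
    unfolding curve_length_alt using us by (intro SUP_upper) auto
  finally show "ereal (\<phi> t - \<phi> s) \<le> curve_length UNIV c + ereal e"
    by (simp add: add_right_mono)
qed

section \<open>The Schwarz-Pick inequality for the upper half-plane\<close>

text \<open>For \<open>w\<close> in the upper half-plane, \<open>(z - w) / (z - cnj w)\<close> is the Cayley transform that maps the
half-plane onto the disc and \<open>w\<close> to \<open>0\<close>; its inverse is \<open>(w - u * cnj w) / (1 - u)\<close>.\<close>

lemma Im_cayley_pos:
  assumes "Im w > 0" "norm u < 1"
  shows "Im ((w - u * cnj w) / (1 - u)) > 0"
proof -
  have "u \<noteq> 1" using assms by auto
  then have pos: "(norm (1 - u))\<^sup>2 > 0" by simp
  have "Im ((w - u * cnj w) * cnj (1 - u)) = Im w * (1 - (norm u)\<^sup>2)"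
    unfolding cmod_power2 by (simp add: algebra_simps power2_eq_square)
  moreover have "(norm u)\<^sup>2 < 1"
    using assms by (simp add: power_less_one_iff abs_square_less_1)
  ultimately have "Im ((w - u * cnj w) * cnj (1 - u)) > 0"
    using assms by simp
  then show ?thesis
    using pos by (simp add: complex_div_cnj[of _ "1 - u"] Im_divide_of_real flip: of_real_power)
qed

lemma norm_cayley_less_1:
  assumes "Im z > 0" "Im w > 0"
  shows "norm ((z - w) / (z - cnj w)) < 1"
proof -
  have "(norm (z - w))\<^sup>2 < (norm (z - cnj w))\<^sup>2"
    using mult_pos_pos[OF assms] unfolding cmod_power2
    by (simp add: power2_eq_square algebra_simps)
  then have "norm (z - w) < norm (z - cnj w)"
    by (rule power2_less_imp_less) simp
  then show ?thesis
    by (metis divide_less_eq_1_pos norm_divide norm_ge_zero order_le_less_trans)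
qed

lemma cayley_inj:
  assumes "Im z > 0" "Im z' > 0" "Im w > 0"
    and eq: "(z - w) / (z - cnj w) = (z' - w) / (z' - cnj w)"
  shows "z = z'"
proof -
  have ne: "z - cnj w \<noteq> 0" "z' - cnj w \<noteq> 0" "w - cnj w \<noteq> 0"
    using assms by (auto simp: complex_eq_iff)
  then have "(z - w) * (z' - cnj w) = (z' - w) * (z - cnj w)"
    using eq by (simp add: frac_eq_eq)
  then have "(z - z') * (w - cnj w) = 0"
    by (simp add: algebra_simps)
  with ne show ?thesis by simp
qed

context
  fixes F :: "complex \<Rightarrow> complex"
  assumes holF: "F holomorphic_on ball 0 1"
    and ImF: "\<And>z. norm z < 1 \<Longrightarrow> Im (F z) > 0"
begin

definition normalized :: "complex \<Rightarrow> complex" where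
  "normalized z = (F z - F 0) / (F z - cnj (F 0))"

lemma normalized_denominator: "norm z < 1 \<Longrightarrow> F z - cnj (F 0) \<noteq> 0"
  using ImF[of z] ImF[of 0] by (auto simp: complex_eq_iff)

lemma normalized_holomorphic: "normalized holomorphic_on ball 0 1"
  unfolding normalized_def
  using normalized_denominator by (intro holomorphic_intros holF) auto

lemma normalized_0: "normalized 0 = 0"
  by (simp add: normalized_def)

lemma normalized_less_1: "norm z < 1 \<Longrightarrow> norm (normalized z) < 1"
  unfolding normalized_def by (rule norm_cayley_less_1) (simp_all add: ImF)

lemma deriv_normalized: "deriv normalized 0 = deriv F 0 / (2 * \<i> * Im (F 0))"
proof -
  have F: "(F has_field_derivative deriv F 0) (at 0)"
    using holF by (intro holomorphic_derivI[of _ "ball 0 1"]) auto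
  have ne: "F 0 - cnj (F 0) \<noteq> 0" using normalized_denominator[of 0] by simp
  have "(normalized has_field_derivative deriv F 0 / (F 0 - cnj (F 0))) (at 0)"
    unfolding normalized_def[abs_def]
    by (rule derivative_eq_intros F refl ne)+ (use ne in simp)
  then show ?thesis by (simp add: DERIV_imp_deriv complex_diff_cnj mult_ac)
qed

lemma schwarz_upper_half_plane: "norm (normalized z) \<le> norm z" if "norm z < 1"
  using Schwarz_Lemma(1)[OF normalized_holomorphic normalized_0 normalized_less_1 that] .

lemma schwarz_pick_deriv: "norm (deriv F 0) \<le> 2 * Im (F 0)"
  using Schwarz_Lemma(2)[OF normalized_holomorphic normalized_0 normalized_less_1, of 0]
    ImF[of 0] by (simp add: deriv_normalized norm_divide norm_mult)

text \<open>Equality in the Schwarz lemma makes the normalized function a rotation of the disc, which is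
onto.\<close>

lemma schwarz_pick_equality_imp_onto:
  assumes eq: "norm (deriv F 0) = 2 * Im (F 0)"
  shows "F ` ball 0 1 = {z. Im z > 0}"
proof
  show "F ` ball 0 1 \<subseteq> {z. Im z > 0}" using ImF by auto
  have "norm (deriv normalized 0) = 1"
    using ImF[of 0] by (simp add: deriv_normalized norm_divide norm_mult eq)
  then obtain \<alpha> where \<alpha>: "\<And>z. norm z < 1 \<Longrightarrow> normalized z = \<alpha> * z" "norm \<alpha> = 1"
    using Schwarz_Lemma(3)[OF normalized_holomorphic normalized_0 normalized_less_1, of 0] by auto
  show "{z. Im z > 0} \<subseteq> F ` ball 0 1"
  proof
    fix z assume "z \<in> {z. Im z > 0}"
    then have z: "Im z > 0" by simp
    define u where "u = (z - F 0) / (z - cnj (F 0))"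
    have u: "norm (u / \<alpha>) < 1"
      using norm_cayley_less_1[OF z ImF[of 0]] \<alpha> by (simp add: u_def norm_divide norm_mult)
    have "normalized (u / \<alpha>) = u" using \<alpha> u by auto
    then have "F (u / \<alpha>) = z"
      using cayley_inj[OF ImF[OF u] z ImF[of 0]] by (simp add: normalized_def u_def)
    with u show "z \<in> F ` ball 0 1" by force
  qed
qed

text \<open>The inverse of \<open>F\<close>, precomposed with the inverse Cayley transform \<open>C\<close>, is a self-map of the disc
fixing \<open>0\<close>. The Schwarz lemma for it gives the converse inequality.\<close>

lemma schwarz_pick_equality_if_bij:
  assumes inj: "inj_on F (ball 0 1)" and onto: "F ` ball 0 1 = {z. Im z > 0}"
  shows "norm (deriv F 0) = 2 * Im (F 0)"
proof (rule antisym[OF schwarz_pick_deriv])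
  obtain G where G: "G holomorphic_on F ` ball 0 1"
    "\<And>z. z \<in> ball 0 1 \<Longrightarrow> deriv F z * deriv G (F z) = 1"
    "\<And>z. z \<in> ball 0 1 \<Longrightarrow> G (F z) = z"
    using holomorphic_has_inverse[OF holF open_ball inj] by metis
  define w where "w = F 0"
  have w: "Im w > 0" using ImF[of 0] by (simp add: w_def)
  define C where "C u = (w - u * cnj w) / (1 - u)" for u
  have holC: "C holomorphic_on ball 0 1"
    unfolding C_def by (intro holomorphic_intros) auto
  have C: "C u \<in> F ` ball 0 1" if "norm u < 1" for u
    unfolding onto C_def using Im_cayley_pos[OF w that] by simp
  have hol: "G \<circ> C holomorphic_on ball 0 1"
    by (rule holomorphic_on_compose_gen[OF holC G(1)]) (auto intro: C)
  have less: "norm ((G \<circ> C) u) < 1" if "norm u < 1" for u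
    using C[OF that] G(3) by auto
  have "(G \<circ> C) 0 = 0" using G(3)[of 0] by (simp add: C_def w_def)
  then have le: "norm (deriv (G \<circ> C) 0) \<le> 1"
    using Schwarz_Lemma(2)[OF hol _ less, of 0] by (simp add: o_def)
  have dC: "(C has_field_derivative w - cnj w) (at 0)"
    unfolding C_def[abs_def] by (rule derivative_eq_intros refl | simp)+
  have dG: "(G has_field_derivative deriv G w) (at (C 0))"
  proof -
    have "w \<in> F ` ball 0 1" "open (F ` ball 0 1)"
      unfolding onto using w by (auto simp: open_halfspace_Im_gt)
    then show ?thesis
      using holomorphic_derivI[OF G(1)] by (simp add: C_def)
  qed
  have "deriv (G \<circ> C) 0 = deriv G w * (w - cnj w)"
    using DERIV_chain[OF dG dC] by (rule DERIV_imp_deriv)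
  then have "norm (deriv G w) * (2 * Im w) \<le> 1"
    using le w by (simp add: norm_mult complex_diff_cnj)
  moreover have "norm (deriv F 0) * norm (deriv G w) = 1"
    using G(2)[of 0] by (metis centre_in_ball norm_mult norm_one w_def zero_less_one)
  ultimately have "norm (deriv F 0) * (norm (deriv G w) * (2 * Im w)) \<le> norm (deriv F 0)"
    by (metis mult.right_neutral mult_left_mono norm_ge_zero)
  then show "2 * Im (F 0) \<le> norm (deriv F 0)"
    using \<open>norm (deriv F 0) * norm (deriv G w) = 1\<close> by (simp add: w_def flip: mult.assoc)
qed

end

text \<open>The principal square root \<open>q\<close> of \<open>f\<close> has positive real part, and \<open>p = q z0\<close> is positive. On the
ball of half the radius the Schwarz lemma gives \<open>\<bar>q - p\<bar> \<le> \<bar>q + p\<bar> / 2\<close>, hence \<open>\<bar>q\<bar> \<le> 3 p\<close>, and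
squaring produces the constant \<open>9\<close>.\<close>

lemma norm_le_9_if_slit:
  assumes hol: "f holomorphic_on ball z0 r" and r: "r > 0"
    and slit: "\<And>z. z \<in> ball z0 r \<Longrightarrow> f z \<notin> \<real>\<^sub>\<le>\<^sub>0"
    and real: "f z0 \<in> \<real>" and z: "dist z z0 \<le> r / 2"
  shows "norm (f z) \<le> 9 * norm (f z0)"
proof -
  \<comment> \<open>The factor \<open>\<i>\<close> turns the right half-plane into the upper one.\<close>
  define F where "F v = \<i> * csqrt (f (z0 + of_real r * v))" for v
  have in_ball: "z0 + of_real r * v \<in> ball z0 r" if "norm v < 1" for v
    using that r by (simp add: dist_norm norm_mult)
  have holF: "F holomorphic_on ball 0 1"
  proof -
    have "(\<lambda>v. f (z0 + of_real r * v)) holomorphic_on ball 0 1"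
      by (rule holomorphic_on_compose_gen[OF _ hol, unfolded o_def])
         (use in_ball in \<open>auto intro!: holomorphic_intros\<close>)
    then show ?thesis
      unfolding F_def using slit in_ball by (intro holomorphic_intros) auto
  qed
  have ImF: "Im (F v) > 0" if "norm v < 1" for v
  proof -
    define w where "w = f (z0 + of_real r * v)"
    have w: "w \<notin> \<real>\<^sub>\<le>\<^sub>0" using slit[OF in_ball[OF that]] by (simp add: w_def)
    have "Re (csqrt w) \<noteq> 0"
    proof
      assume "Re (csqrt w) = 0"
      then have "csqrt w = \<i> * Im (csqrt w)" by (simp add: complex_eq_iff)
      then have "w = of_real (- (Im (csqrt w))\<^sup>2)"
        by (metis i_squared mult_minus1 of_real_minus of_real_power power2_csqrt power2_i power_mult_distrib)
      with w show False
        by (metis neg_le_0_iff_le nonpos_Reals_of_real_iff zero_le_power2)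
    qed
    then show ?thesis
      using csqrt_principal[of w] by (auto simp: F_def w_def)
  qed
  define p where "p = csqrt (f z0)"
  have "f z0 \<notin> \<real>\<^sub>\<le>\<^sub>0" using slit r by simp
  with real obtain t where t: "f z0 = of_real t" "t > 0"
    by (auto simp: complex_nonpos_Reals_iff elim!: Reals_cases)
  then have p: "p = of_real (sqrt t)" by (simp add: p_def)
  define v where "v = (z - z0) / of_real r"
  define q where "q = csqrt (f z)"
  have v: "norm v \<le> 1 / 2" "z0 + of_real r * v = z"
    using z r by (auto simp: v_def norm_divide dist_norm field_simps)
  have F: "F v = \<i> * q" "F 0 = \<i> * p" by (auto simp: F_def v q_def p_def)
  have "norm ((F v - F 0) / (F v - cnj (F 0))) \<le> 1 / 2"
    using schwarz_upper_half_plane[OF holF ImF, of v] v by (simp add: normalized_def[OF holF ImF])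
  moreover have "F v - F 0 = \<i> * (q - p)" "F v - cnj (F 0) = \<i> * (q + p)"
    by (simp_all add: F p algebra_simps)
  moreover have "q + p \<noteq> 0"
  proof -
    have "Re (q + p) > 0"
      using ImF[of v] v real_sqrt_gt_zero[OF t(2)] by (simp add: F p del: real_sqrt_gt_0_iff)
    then show ?thesis by (metis order_less_irrefl zero_complex.sel(1))
  qed
  ultimately have "norm (q - p) \<le> 1 / 2 * norm (q + p)"
    by (simp add: norm_divide norm_mult divide_le_eq)
  moreover have "norm q \<le> norm (q - p) + norm p" "norm (q + p) \<le> norm q + norm p"
    by norm+
  ultimately have "norm q \<le> 3 * norm p" by linarith
  then have "(norm q)\<^sup>2 \<le> (3 * norm p)\<^sup>2" by (intro power_mono) auto
  then show ?thesis
    by (simp add: power_mult_distrib q_def p_def flip: norm_power)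
qed

section \<open>The strip as a model of the disc\<close>

definition strip :: "real \<Rightarrow> complex set" where
  "strip r = {z. \<bar>Im z\<bar> < r}"

text \<open>This is \<open>tanh (z / 2)\<close>, written so that \<open>(1 + w) / (1 - w) = exp z\<close> is easy to read off.\<close>

definition strip_to_disc :: "complex \<Rightarrow> complex" where
  "strip_to_disc z = (exp z - 1) / (exp z + 1)"

definition disc_to_strip :: "complex \<Rightarrow> complex" where
  "disc_to_strip w = Ln ((1 + w) / (1 - w))"

lemma strip_altdef: "strip r = {z. - r < Im z} \<inter> {z. Im z < r}"
  by (auto simp: strip_def)

lemma open_strip: "open (strip r)"
  unfolding strip_altdef by (intro open_Int open_halfspace_Im_gt open_halfspace_Im_lt)

lemma convex_strip: "convex (strip r)"
  unfolding strip_altdef by (intro convex_Int convex_halfspace_Im_gt convex_halfspace_Im_lt)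

lemma Re_exp_strip: "z \<in> strip (pi / 2) \<Longrightarrow> Re (exp z) > 0"
  by (auto simp: strip_def Re_exp cos_gt_zero_pi abs_less_iff)

lemma exp_strip_plus_1: "z \<in> strip (pi / 2) \<Longrightarrow> exp z + 1 \<noteq> 0"
  using Re_exp_strip[of z] by (auto simp: complex_eq_iff)

lemma strip_to_disc_ratio:
  assumes "z \<in> strip (pi / 2)"
  shows "(1 + strip_to_disc z) / (1 - strip_to_disc z) = exp z"
proof -
  have "1 + strip_to_disc z = 2 * exp z / (exp z + 1)" "1 - strip_to_disc z = 2 / (exp z + 1)"
    using exp_strip_plus_1[OF assms] by (simp_all add: strip_to_disc_def divide_simps)
  then show ?thesis using exp_strip_plus_1[OF assms] by simp
qed

lemma strip_to_disc_in_disc: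
  assumes "z \<in> strip (pi / 2)"
  shows "strip_to_disc z \<in> ball 0 1"
proof -
  have "(norm (exp z - 1))\<^sup>2 < (norm (exp z + 1))\<^sup>2"
    using Re_exp_strip[OF assms] unfolding cmod_power2
    by (simp add: power2_eq_square algebra_simps)
  then have "norm (exp z - 1) < norm (exp z + 1)"
    by (rule power2_less_imp_less) simp
  then show ?thesis
    by (simp add: strip_to_disc_def norm_divide divide_less_eq)
qed

lemma Re_disc_ratio: "Re ((1 + w) / (1 - w)) > 0" if "w \<in> ball 0 1"
proof -
  have "1 - w \<noteq> 0" using that by auto
  then have pos: "(norm (1 - w))\<^sup>2 > 0" by simp
  have "(norm w)\<^sup>2 < 1" using that by (simp add: abs_square_less_1)
  then have "Re ((1 + w) * cnj (1 - w)) > 0"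
    unfolding cmod_power2 by (simp add: power2_eq_square algebra_simps)
  then show ?thesis
    using pos by (simp add: complex_div_cnj[of _ "1 - w"] Re_divide_of_real flip: of_real_power)
qed

lemma disc_to_strip_in_strip:
  assumes "w \<in> ball 0 1"
  shows "disc_to_strip w \<in> strip (pi / 2)"
proof -
  have "(1 + w) / (1 - w) \<noteq> 0"
    using Re_disc_ratio[OF assms] by (metis order_less_irrefl zero_complex.sel(1))
  then show ?thesis
    using Re_Ln_pos_lt Re_disc_ratio[OF assms] by (simp add: strip_def disc_to_strip_def)
qed

lemma strip_to_disc_disc_to_strip:
  assumes "w \<in> ball 0 1"
  shows "strip_to_disc (disc_to_strip w) = w"
proof -
  have ne: "1 - w \<noteq> 0" using assms by auto
  have "(1 + w) / (1 - w) \<noteq> 0"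
    using Re_disc_ratio[OF assms] by (metis order_less_irrefl zero_complex.sel(1))
  then have E: "exp (disc_to_strip w) = (1 + w) / (1 - w)" by (simp add: disc_to_strip_def)
  have "exp (disc_to_strip w) - 1 = 2 * w / (1 - w)" "exp (disc_to_strip w) + 1 = 2 / (1 - w)"
    unfolding E using ne by (simp_all add: divide_simps)
  then show ?thesis using ne by (simp add: strip_to_disc_def)
qed

lemma disc_to_strip_strip_to_disc:
  "z \<in> strip (pi / 2) \<Longrightarrow> disc_to_strip (strip_to_disc z) = z"
  by (simp add: disc_to_strip_def strip_to_disc_ratio) (auto simp: strip_def intro!: Ln_exp)

lemma strip_to_disc_image: "strip_to_disc ` strip (pi / 2) = ball 0 1"
  using strip_to_disc_in_disc disc_to_strip_in_strip strip_to_disc_disc_to_strip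
  by (metis (no_types, lifting) image_eqI image_subset_iff subsetI subset_antisym)

lemma disc_to_strip_image: "disc_to_strip ` ball 0 1 = strip (pi / 2)"
  using strip_to_disc_in_disc disc_to_strip_in_strip disc_to_strip_strip_to_disc
  by (metis (no_types, lifting) image_eqI image_subset_iff subsetI subset_antisym)

lemma holomorphic_strip_to_disc: "strip_to_disc holomorphic_on strip (pi / 2)"
  unfolding strip_to_disc_def using exp_strip_plus_1 by (intro holomorphic_intros) auto

lemma holomorphic_disc_to_strip: "disc_to_strip holomorphic_on ball 0 1"
  unfolding disc_to_strip_def
proof (intro holomorphic_intros)
  show "(1 + w) / (1 - w) \<notin> \<real>\<^sub>\<le>\<^sub>0" if "w \<in> ball 0 1" for w :: complex
    using Re_disc_ratio[OF that] by (auto simp: complex_nonpos_Reals_iff)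
qed auto

lemma inj_on_strip_to_disc: "inj_on strip_to_disc (strip (pi / 2))"
  using disc_to_strip_strip_to_disc by (metis inj_on_inverseI)

lemma inj_on_disc_to_strip: "inj_on disc_to_strip (ball 0 1)"
  using strip_to_disc_disc_to_strip by (metis inj_on_inverseI)

lemma strip_to_disc_cnj: "strip_to_disc (cnj z) = cnj (strip_to_disc z)"
  by (simp add: strip_to_disc_def exp_cnj)

lemma strip_to_disc_0: "strip_to_disc 0 = 0"
  by (simp add: strip_to_disc_def)

lemma disc_to_strip_0: "disc_to_strip 0 = 0"
  by (simp add: disc_to_strip_def)

lemma DERIV_strip_to_disc_0: "(strip_to_disc has_field_derivative 1 / 2) (at 0)"
  unfolding strip_to_disc_def[abs_def] by (auto intro!: derivative_eq_intros)

lemma DERIV_disc_to_strip_0: "(disc_to_strip has_field_derivative 2) (at 0)"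
  unfolding disc_to_strip_def[abs_def] by (auto intro!: derivative_eq_intros)

lemma strip_to_disc_of_real:
  "strip_to_disc (of_real x) = of_real ((exp x - 1) / (exp x + 1))"
  by (simp add: strip_to_disc_def exp_of_real)

text \<open>In the strip coordinate \<open>(w - 1) / (w + 1) = - exp (- z)\<close>, whose argument is \<open>pi - Im z\<close> on
and above the real axis and negative below it.\<close>

lemma Gamma_arc_eq: "Gamma_arc = strip_to_disc ` {z. Im z = pi / 4}"
proof -
  have iff: "Arg ((strip_to_disc z - 1) / (strip_to_disc z + 1)) = 3 * pi / 4 \<longleftrightarrow> Im z = pi / 4"
    if z: "z \<in> strip (pi / 2)" for z
  proof -
    have eq: "(strip_to_disc z - 1) / (strip_to_disc z + 1) = exp (\<i> * of_real pi - z)"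
    proof -
      have cancel: "(- 2 / q) / (2 * p / q) = - 1 / p" if "q \<noteq> 0" for p q :: complex
        using that by (cases "p = 0") (simp_all add: divide_simps)
      have "strip_to_disc z - 1 = - 2 / (exp z + 1)" "strip_to_disc z + 1 = 2 * exp z / (exp z + 1)"
        using exp_strip_plus_1[OF z] by (simp_all add: strip_to_disc_def divide_simps)
      then have "(strip_to_disc z - 1) / (strip_to_disc z + 1) = - 1 / exp z"
        using cancel[OF exp_strip_plus_1[OF z], of "exp z"] by (simp only:)
      then show ?thesis by (simp add: exp_diff)
    qed
    show ?thesis
    proof (cases "Im z \<ge> 0")
      case True
      then have "Ln (exp (\<i> * of_real pi - z)) = \<i> * of_real pi - z"
        using z by (intro Ln_exp) (auto simp: strip_def)
      then have "Arg (exp (\<i> * of_real pi - z)) = pi - Im z"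
        by (simp add: Arg_eq_Im_Ln)
      then show ?thesis unfolding eq by auto
    next
      case False
      have "exp (\<i> * of_real pi - z) = exp (- \<i> * of_real pi - z)"
        by (simp add: exp_diff exp_minus)
      moreover have "Ln (exp (- \<i> * of_real pi - z)) = - \<i> * of_real pi - z"
        using z False by (intro Ln_exp) (auto simp: strip_def)
      ultimately have "Arg (exp (\<i> * of_real pi - z)) = - pi - Im z"
        by (simp add: Arg_eq_Im_Ln)
      moreover have "- pi - Im z < 0" using z by (auto simp: strip_def abs_less_iff)
      ultimately show ?thesis unfolding eq using False pi_gt_zero by linarith
    qed
  qed
  show ?thesis
  proof (intro equalityI subsetI)
    fix w assume "w \<in> Gamma_arc"
    then have w: "w \<in> ball 0 1" "Arg ((w - 1) / (w + 1)) = 3 * pi / 4"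
      by (auto simp: Gamma_arc_def)
    then have "Im (disc_to_strip w) = pi / 4"
      using iff[OF disc_to_strip_in_strip[OF w(1)]] by (simp add: strip_to_disc_disc_to_strip)
    with w show "w \<in> strip_to_disc ` {z. Im z = pi / 4}"
      by (metis (mono_tags) image_eqI mem_Collect_eq strip_to_disc_disc_to_strip)
  next
    fix w assume "w \<in> strip_to_disc ` {z. Im z = pi / 4}"
    then obtain z where z: "w = strip_to_disc z" "Im z = pi / 4" by auto
    then have "z \<in> strip (pi / 2)" by (simp add: strip_def z(2))
    with z iff[of z] strip_to_disc_in_disc[of z] show "w \<in> Gamma_arc"
      by (simp add: Gamma_arc_def)
  qed
qed

section \<open>Real functions on the line\<close>

lemma strict_mono_less_lim_top:
  fixes f :: "real \<Rightarrow> real"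
  assumes "strict_mono f" "(f \<longlongrightarrow> l) at_top" shows "f x < l"
proof -
  have "\<forall>\<^sub>F y in at_top. f (x + 1) \<le> f y"
    using eventually_ge_at_top[of "x + 1"] by eventually_elim (use assms in \<open>simp add: strict_mono_less_eq\<close>)
  then have "f (x + 1) \<le> l"
    using assms(2) by (intro tendsto_lowerbound) auto
  moreover have "f x < f (x + 1)" using assms(1) by (simp add: strict_mono_less)
  ultimately show ?thesis by simp
qed

lemma strict_mono_greater_lim_bot:
  fixes f :: "real \<Rightarrow> real"
  assumes "strict_mono f" "(f \<longlongrightarrow> l) at_bot" shows "l < f x"
proof -
  have "\<forall>\<^sub>F y in at_bot. f y \<le> f (x - 1)"
    using eventually_le_at_bot[of "x - 1"] by eventually_elim (use assms in \<open>simp add: strict_mono_less_eq\<close>)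
  then have "l \<le> f (x - 1)"
    using assms(2) by (intro tendsto_upperbound) auto
  moreover have "f (x - 1) < f x" using assms(1) by (simp add: strict_mono_less)
  ultimately show ?thesis by simp
qed

lemma continuous_has_antiderivative:
  fixes f :: "real \<Rightarrow> real"
  assumes "continuous_on UNIV f"
  obtains F where "\<And>x. (F has_real_derivative f x) (at x)"
proof
  fix x :: real
  define r where "r = \<bar>x\<bar> + 1"
  have "continuous_on {- r..r} f" using assms continuous_on_subset by blast
  then have "((\<lambda>v. LBINT y=ereal 0..ereal v. f y) has_vector_derivative f x) (at x within {- r..r})"
    by (intro interval_integral_FTC2) (auto simp: r_def)
  moreover have "at x within {- r..r} = at x"
    by (rule at_within_interior) (auto simp: r_def interior_atLeastAtMost_real)
  ultimately show "((\<lambda>v. LBINT y=ereal 0..ereal v. f y) has_real_derivative f x) (at x)"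
    by (simp add: has_real_derivative_iff_has_vector_derivative)
qed

section \<open>Real univalent functions on the strip\<close>

text \<open>This is \<open>g \<circ> strip_to_disc\<close> for a totally real univalent \<open>g\<close>: reality of the Taylor coefficients
becomes symmetry under conjugation, and the radial limits become limits along the real line.\<close>

locale real_univalent_strip =
  fixes h :: "complex \<Rightarrow> complex" and a b :: real
  assumes hol: "h holomorphic_on strip (pi / 2)"
    and inj: "inj_on h (strip (pi / 2))"
    and h_cnj: "z \<in> strip (pi / 2) \<Longrightarrow> h (cnj z) = cnj (h z)"
    and pos: "Re (deriv h 0) > 0"
    and lim_bot: "((\<lambda>x. h (of_real x)) \<longlongrightarrow> of_real a) at_bot"
    and lim_top: "((\<lambda>x. h (of_real x)) \<longlongrightarrow> of_real b) at_top"
begin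

abbreviation upper :: "complex set" where
  "upper \<equiv> {z. 0 < Im z \<and> Im z < pi / 2}"

definition u :: "real \<Rightarrow> real" where "u x = Re (h (of_real x))"

lemma of_real_in_strip [simp]: "of_real x \<in> strip (pi / 2)"
  by (simp add: strip_def)

lemma upper_subset: "upper \<subseteq> strip (pi / 2)"
  by (auto simp: strip_def)

lemma deriv_h: "z \<in> strip (pi / 2) \<Longrightarrow> (h has_field_derivative deriv h z) (at z)"
  by (rule holomorphic_derivI[OF hol open_strip])

lemma h_of_real: "h (of_real x) = of_real (u x)"
  using h_cnj[of "of_real x"] by (simp add: u_def complex_eq_iff)

text \<open>If \<open>h z\<close> is real then \<open>h (cnj z) = h z\<close>, and univalence forces \<open>z = cnj z\<close>.\<close>

lemma Im_h_eq_0: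
  assumes "z \<in> strip (pi / 2)" "Im (h z) = 0"
  shows "Im z = 0"
proof -
  have "h (cnj z) = h z" using assms h_cnj by (simp add: complex_eq_iff)
  then have "cnj z = z"
    using inj_onD[OF inj] assms by (simp add: strip_def)
  then show ?thesis by (simp add: complex_eq_iff)
qed

lemma h_vector_derivative_horizontal:
  assumes "\<bar>y\<bar> < pi / 2"
  shows "((\<lambda>x. h (of_real x + \<i> * of_real y)) has_vector_derivative deriv h (of_real x + \<i> * of_real y)) (at x)"
proof -
  have "((\<lambda>x. of_real x + \<i> * of_real y) has_vector_derivative 1) (at x)"
    by (auto intro!: derivative_eq_intros)
  from field_vector_diff_chain_at[OF this deriv_h] assms show ?thesis
    by (simp add: o_def strip_def)
qed

lemma h_vector_derivative_vertical:
  assumes "\<bar>y\<bar> < pi / 2"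
  shows "((\<lambda>y. h (of_real x + \<i> * of_real y)) has_vector_derivative
    \<i> * deriv h (of_real x + \<i> * of_real y)) (at y)"
proof -
  have "((\<lambda>y. of_real x + \<i> * of_real y) has_vector_derivative \<i>) (at y)"
    by (auto intro!: derivative_eq_intros)
  from field_vector_diff_chain_at[OF this deriv_h] assms show ?thesis
    by (simp add: o_def strip_def)
qed

text \<open>\<open>Im h\<close> has no zero in the connected upper half strip, and it is positive at points \<open>\<i> y\<close> with small
\<open>y > 0\<close> because its vertical derivative at \<open>0\<close> is \<open>Re (h' 0)\<close>.\<close>

lemma Im_h_pos:
  assumes "z \<in> upper" shows "Im (h z) > 0"
proof -
  have "((\<lambda>y. h (\<i> * of_real y)) has_vector_derivative \<i> * deriv h 0) (at 0)"
    using h_vector_derivative_vertical[of 0 0] by simp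
  from bounded_linear.has_vector_derivative[OF bounded_linear_Im this]
  have "((\<lambda>y. Im (h (\<i> * of_real y))) has_real_derivative Re (deriv h 0)) (at 0)"
    by (simp add: has_real_derivative_iff_has_vector_derivative)
  from DERIV_pos_inc_right[OF this pos]
  obtain d where d: "d > 0" "\<And>y. 0 < y \<Longrightarrow> y < d \<Longrightarrow> Im (h 0) < Im (h (\<i> * of_real y))"
    by auto
  define y where "y = min (d / 2) (pi / 4)"
  have y: "0 < y" "y < d" "y < pi / 2" using d(1) pi_gt_zero by (auto simp: y_def min_def)
  have "Im (h 0) = 0" using h_of_real[of 0] by simp
  with d(2) y have w: "\<i> * of_real y \<in> upper" "Im (h (\<i> * of_real y)) > 0" by auto
  have "upper = {z. 0 < Im z} \<inter> {z. Im z < pi / 2}" by auto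
  then have "convex upper"
    by (metis convex_Int convex_halfspace_Im_gt convex_halfspace_Im_lt)
  moreover have "continuous_on upper (\<lambda>z. Im (h z))"
    using hol upper_subset
    by (intro continuous_intros) (meson holomorphic_on_imp_continuous_on holomorphic_on_subset)
  ultimately have conn: "connected ((\<lambda>z. Im (h z)) ` upper)"
    using connected_continuous_image convex_connected by blast
  have no0: "0 \<notin> (\<lambda>z. Im (h z)) ` upper"
    using Im_h_eq_0 upper_subset by fastforce
  show ?thesis
  proof (rule ccontr)
    assume "\<not> Im (h z) > 0"
    then have "0 \<in> (\<lambda>z. Im (h z)) ` upper"
      using connectedD_interval[OF conn, of "Im (h z)" "Im (h (\<i> * of_real y))" 0] w assms
      by fastforce
    with no0 show False ..
  qed
qed

lemma Im_h_neg: "cnj z \<in> upper \<Longrightarrow> Im (h z) < 0"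
  using Im_h_pos[of "cnj z"] h_cnj[of z] by (auto simp: strip_def)

text \<open>A continuous injective real function is strictly monotone, and the positive derivative at \<open>0\<close>
decides the direction.\<close>

lemma u_strict_mono: "strict_mono u"
proof -
  have der: "((\<lambda>x. h (of_real x)) has_vector_derivative deriv h (of_real x)) (at x)" for x
    using h_vector_derivative_horizontal[of 0 x] by simp
  have du: "(u has_real_derivative Re (deriv h (of_real x))) (at x)" for x
    unfolding u_def[abs_def] has_real_derivative_iff_has_vector_derivative
    by (rule bounded_linear.has_vector_derivative[OF bounded_linear_Re der])
  then have "continuous_on UNIV u"
    by (meson DERIV_isCont continuous_at_imp_continuous_on)
  moreover have "inj u"
    using inj by (auto intro!: injI dest: inj_onD simp: h_of_real[symmetric])
      (metis h_of_real inj_onD of_real_eq_iff of_real_in_strip)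
  ultimately have "strict_mono_on UNIV u \<or> strict_antimono_on UNIV u"
    using injective_eq_monotone_map[of UNIV u] by simp
  moreover have "\<not> strict_antimono_on UNIV u"
  proof
    assume anti: "strict_antimono_on UNIV u"
    obtain d where d: "d > 0" "\<And>y. 0 < y \<Longrightarrow> y < d \<Longrightarrow> u 0 < u y"
      using DERIV_pos_inc_right[OF du[of 0]] pos by auto
    have "u 0 < u (d / 2)" using d by simp
    moreover have "u (d / 2) < u 0" using monotone_onD[OF anti, of 0 "d / 2"] d(1) by simp
    ultimately show False by simp
  qed
  ultimately show ?thesis by blast
qed

lemma u_continuous: "continuous_on S u"
proof -
  have "isCont (\<lambda>x. h (of_real x)) x" for x
    using has_vector_derivative_continuous[OF h_vector_derivative_horizontal[of 0 x]] by simp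
  then have "isCont u x" for x
    unfolding u_def[abs_def] isCont_def by (intro tendsto_Re)
  then show ?thesis
    by (simp add: continuous_at_imp_continuous_on)
qed

lemma u_lim_top: "(u \<longlongrightarrow> b) at_top"
  using tendsto_Re[OF lim_top] by (simp add: u_def[abs_def])

lemma u_lim_bot: "(u \<longlongrightarrow> a) at_bot"
  using tendsto_Re[OF lim_bot] by (simp add: u_def[abs_def])

lemma u_bounds: "a < u x" "u x < b"
  using strict_mono_less_lim_top[OF u_strict_mono u_lim_top]
    strict_mono_greater_lim_bot[OF u_strict_mono u_lim_bot] by auto

lemma range_u: "range u = {a<..<b}"
proof
  show "range u \<subseteq> {a<..<b}" using u_bounds by auto
  show "{a<..<b} \<subseteq> range u"
  proof
    fix t assume t: "t \<in> {a<..<b}"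
    obtain x where x: "u x < t"
      using order_tendstoD(2)[OF u_lim_bot, of t] t eventually_happens'[OF trivial_limit_at_bot_linorder]
      by (metis greaterThanLessThan_iff)
    obtain y where y: "t < u y"
      using order_tendstoD(1)[OF u_lim_top, of t] t eventually_happens'[OF trivial_limit_at_top_linorder]
      by (metis greaterThanLessThan_iff)
    have "x \<le> y" using x y u_strict_mono by (meson le_less_linear less_trans not_less_iff_gr_or_eq strict_mono_less)
    then show "t \<in> range u"
      using IVT'[of u x t y] x y u_continuous by auto
  qed
qed

lemma h_real_imp_between:
  assumes "z \<in> strip (pi / 2)" "Im (h z) = 0" shows "a < Re (h z)" "Re (h z) < b"
proof -
  have "z = of_real (Re z)" using Im_h_eq_0[OF assms] by (simp add: complex_eq_iff)
  then have "Re (h z) = u (Re z)" by (metis u_def)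
  with u_bounds show "a < Re (h z)" "Re (h z) < b" by auto
qed

section \<open>Convergence at the ends of the strip\<close>

lemma ball_subset_strip: "ball (complex_of_real x) (pi / 2) \<subseteq> strip (pi / 2)"
proof
  fix z assume "z \<in> ball (of_real x :: complex) (pi / 2)"
  then have "norm (z - of_real x) < pi / 2" by (simp add: dist_norm norm_minus_commute)
  moreover have "\<bar>Im z\<bar> \<le> norm (z - of_real x)"
    using abs_Im_le_cmod[of "z - of_real x"] by simp
  ultimately show "z \<in> strip (pi / 2)" by (simp add: strip_def)
qed

text \<open>These two estimates upgrade the limits along the real axis to uniform limits on vertical
segments. A ball of radius \<open>pi / 2\<close> about a real point lies in the strip, and the height \<open>pi / 4\<close>
is half of that radius.\<close>

lemma dist_limit_top:
  assumes "\<bar>y\<bar> \<le> pi / 4"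
  shows "norm (h (of_real x + \<i> * of_real y) - of_real b) \<le> 9 * (b - u x)"
proof -
  have "norm (of_real b - h (of_real x + \<i> * of_real y)) \<le> 9 * norm (of_real b - h (of_real x))"
  proof (rule norm_le_9_if_slit[where f = "\<lambda>z. of_real b - h z" and ?z0.0 = "of_real x" and r = "pi / 2"])
    show "(\<lambda>z. of_real b - h z) holomorphic_on ball (complex_of_real x) (pi / 2)"
      by (intro holomorphic_intros holomorphic_on_subset[OF hol ball_subset_strip])
    show "of_real b - h z \<notin> \<real>\<^sub>\<le>\<^sub>0" if "z \<in> ball (complex_of_real x) (pi / 2)" for z
    proof
      assume "of_real b - h z \<in> \<real>\<^sub>\<le>\<^sub>0"
      then have "Im (h z) = 0" "Re (h z) \<ge> b"
        by (auto simp: complex_nonpos_Reals_iff)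
      with h_real_imp_between(2)[of z] that ball_subset_strip show False by force
    qed
  qed (use assms in \<open>auto simp: h_of_real dist_norm norm_mult\<close>)
  also have "norm (of_real b - h (of_real x)) = b - u x"
    using u_bounds[of x] by (simp add: h_of_real flip: of_real_diff)
  finally show ?thesis by (simp add: norm_minus_commute)
qed

lemma dist_limit_bot:
  assumes "\<bar>y\<bar> \<le> pi / 4"
  shows "norm (h (of_real x + \<i> * of_real y) - of_real a) \<le> 9 * (u x - a)"
proof -
  have "norm (h (of_real x + \<i> * of_real y) - of_real a) \<le> 9 * norm (h (of_real x) - of_real a)"
  proof (rule norm_le_9_if_slit[where f = "\<lambda>z. h z - of_real a" and ?z0.0 = "of_real x" and r = "pi / 2"])
    show "(\<lambda>z. h z - of_real a) holomorphic_on ball (complex_of_real x) (pi / 2)"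
      by (intro holomorphic_intros holomorphic_on_subset[OF hol ball_subset_strip])
    show "h z - of_real a \<notin> \<real>\<^sub>\<le>\<^sub>0" if "z \<in> ball (complex_of_real x) (pi / 2)" for z
    proof
      assume "h z - of_real a \<in> \<real>\<^sub>\<le>\<^sub>0"
      then have "Im (h z) = 0" "Re (h z) \<le> a"
        by (auto simp: complex_nonpos_Reals_iff)
      with h_real_imp_between(1)[of z] that ball_subset_strip show False by force
    qed
  qed (use assms in \<open>auto simp: h_of_real dist_norm norm_mult\<close>)
  also have "norm (h (of_real x) - of_real a) = u x - a"
    using u_bounds[of x] by (simp add: h_of_real flip: of_real_diff)
  finally show ?thesis .
qed

definition line :: "real \<Rightarrow> complex" where
  "line x = of_real x + \<i> * of_real (pi / 4)"

lemma line_in_upper: "line x \<in> upper"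
  by (simp add: line_def)

lemma line_in_strip: "line x \<in> strip (pi / 2)"
  using line_in_upper upper_subset by blast

text \<open>\<open>V\<close> is the imaginary part of a primitive \<open>P\<close> of \<open>h\<close> on the line \<open>Im z = pi / 4\<close>, and \<open>\<kappa>\<close> is the
constant value of \<open>Im P\<close> on the real axis. The rise of \<open>Im P\<close> between the two lines is \<open>pi / 4\<close> times a
value of \<open>Re h\<close> on a vertical segment, which tends to \<open>b\<close> and \<open>a\<close> at the two ends. This replaces
Cauchy's theorem on long rectangles.\<close>

lemma flux_potential:
  obtains V \<kappa> where "\<And>x. (V has_real_derivative Im (h (line x))) (at x)"
    "(V \<longlongrightarrow> \<kappa> + pi / 4 * b) at_top" "(V \<longlongrightarrow> \<kappa> + pi / 4 * a) at_bot"
proof -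
  obtain P where "\<And>z. z \<in> strip (pi / 2) \<Longrightarrow> (P has_field_derivative h z) (at z within strip (pi / 2))"
    using holomorphic_convex_primitive'[OF convex_strip open_strip hol] by blast
  then have P: "(P has_field_derivative h z) (at z)" if "z \<in> strip (pi / 2)" for z
    using that by (metis at_within_open open_strip)
  define Q where "Q x y = Im (P (of_real x + \<i> * of_real y))" for x y :: real
  have in_strip: "of_real x + \<i> * of_real y \<in> strip (pi / 2)" if "\<bar>y\<bar> \<le> pi / 4" for x y :: real
  proof -
    have "\<bar>y\<bar> < pi / 2" using that pi_gt_zero by linarith
    then show ?thesis by (simp add: strip_def)
  qed
  have Qx: "((\<lambda>x. Q x y) has_real_derivative Im (h (of_real x + \<i> * of_real y))) (at x)"
    if "\<bar>y\<bar> \<le> pi / 4" for x y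
  proof -
    have "((\<lambda>x. of_real x + \<i> * of_real y) has_vector_derivative 1) (at x)"
      by (auto intro!: derivative_eq_intros)
    from field_vector_diff_chain_at[OF this P[OF in_strip[OF that]]]
    have "((\<lambda>x. P (of_real x + \<i> * of_real y)) has_vector_derivative h (of_real x + \<i> * of_real y)) (at x)"
      by (simp add: o_def)
    from bounded_linear.has_vector_derivative[OF bounded_linear_Im this] show ?thesis
      by (simp add: Q_def has_real_derivative_iff_has_vector_derivative)
  qed
  have Qy: "((\<lambda>y. Q x y) has_real_derivative Re (h (of_real x + \<i> * of_real y))) (at y)"
    if "\<bar>y\<bar> \<le> pi / 4" for x y
  proof -
    have "((\<lambda>y. of_real x + \<i> * of_real y) has_vector_derivative \<i>) (at y)"
      by (auto intro!: derivative_eq_intros)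
    from field_vector_diff_chain_at[OF this P[OF in_strip[OF that]]]
    have "((\<lambda>y. P (of_real x + \<i> * of_real y)) has_vector_derivative \<i> * h (of_real x + \<i> * of_real y)) (at y)"
      by (simp add: o_def)
    from bounded_linear.has_vector_derivative[OF bounded_linear_Im this] show ?thesis
      by (simp add: Q_def has_real_derivative_iff_has_vector_derivative)
  qed
  have Q0: "Q x 0 = Q 0 0" for x
    using DERIV_isconst_all[of "\<lambda>x. Q x 0"] Qx[of 0] by (simp add: h_of_real)
  have mean: "\<exists>y. \<bar>y\<bar> \<le> pi / 4 \<and> Q x (pi / 4) - Q 0 0 = pi / 4 * Re (h (of_real x + \<i> * of_real y))" for x
    using MVT2[of 0 "pi / 4" "Q x" "\<lambda>y. Re (h (of_real x + \<i> * of_real y))"] Qy[of _ x] Q0[of x]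
    by (force simp: abs_le_iff)
  have estimate: "\<bar>Q x (pi / 4) - (Q 0 0 + pi / 4 * l)\<bar> \<le> pi / 4 * (9 * r)"
    if "\<And>y. \<bar>y\<bar> \<le> pi / 4 \<Longrightarrow> norm (h (of_real x + \<i> * of_real y) - of_real l) \<le> 9 * r" for x l r
  proof -
    obtain y where y: "\<bar>y\<bar> \<le> pi / 4"
      "Q x (pi / 4) - Q 0 0 = pi / 4 * Re (h (of_real x + \<i> * of_real y))"
      using mean by blast
    have "\<bar>Re (h (of_real x + \<i> * of_real y)) - l\<bar> \<le> 9 * r"
      using abs_Re_le_cmod[of "h (of_real x + \<i> * of_real y) - of_real l"] that[OF y(1)] by simp
    moreover have "Q x (pi / 4) - (Q 0 0 + pi / 4 * l) = pi / 4 * (Re (h (of_real x + \<i> * of_real y)) - l)"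
      using y(2) by (simp add: algebra_simps)
    ultimately show ?thesis by (simp only: abs_mult) (simp add: mult_left_mono)
  qed
  show thesis
  proof
    show "((\<lambda>x. Q x (pi / 4)) has_real_derivative Im (h (line x))) (at x)" for x
      using Qx[of "pi / 4" x] by (simp add: line_def)
    have "((\<lambda>x. pi / 4 * (9 * (b - u x))) \<longlongrightarrow> pi / 4 * (9 * (b - b))) at_top"
      by (intro tendsto_intros u_lim_top)
    then have lim: "((\<lambda>x. pi / 4 * (9 * (b - u x))) \<longlongrightarrow> 0) at_top" by simp
    have "((\<lambda>x. Q x (pi / 4) - (Q 0 0 + pi / 4 * b)) \<longlongrightarrow> 0) at_top"
    proof (rule Lim_null_comparison[OF _ lim])
      show "\<forall>\<^sub>F x in at_top. norm (Q x (pi / 4) - (Q 0 0 + pi / 4 * b)) \<le> pi / 4 * (9 * (b - u x))"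
      proof (intro always_eventually allI)
        fix x
        have "\<bar>Q x (pi / 4) - (Q 0 0 + pi / 4 * b)\<bar> \<le> pi / 4 * (9 * (b - u x))"
        proof (rule estimate)
          fix y :: real assume "\<bar>y\<bar> \<le> pi / 4"
          then show "norm (h (of_real x + \<i> * of_real y) - of_real b) \<le> 9 * (b - u x)"
            by (rule dist_limit_top)
        qed
        then show "norm (Q x (pi / 4) - (Q 0 0 + pi / 4 * b)) \<le> pi / 4 * (9 * (b - u x))"
          by (simp only: real_norm_def)
      qed
    qed
    then show "((\<lambda>x. Q x (pi / 4)) \<longlongrightarrow> Q 0 0 + pi / 4 * b) at_top"
      by (rule LIM_zero_cancel)
    have "((\<lambda>x. pi / 4 * (9 * (u x - a))) \<longlongrightarrow> pi / 4 * (9 * (a - a))) at_bot"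
      by (intro tendsto_intros u_lim_bot)
    then have lim: "((\<lambda>x. pi / 4 * (9 * (u x - a))) \<longlongrightarrow> 0) at_bot" by simp
    have "((\<lambda>x. Q x (pi / 4) - (Q 0 0 + pi / 4 * a)) \<longlongrightarrow> 0) at_bot"
    proof (rule Lim_null_comparison[OF _ lim])
      show "\<forall>\<^sub>F x in at_bot. norm (Q x (pi / 4) - (Q 0 0 + pi / 4 * a)) \<le> pi / 4 * (9 * (u x - a))"
      proof (intro always_eventually allI)
        fix x
        have "\<bar>Q x (pi / 4) - (Q 0 0 + pi / 4 * a)\<bar> \<le> pi / 4 * (9 * (u x - a))"
        proof (rule estimate)
          fix y :: real assume "\<bar>y\<bar> \<le> pi / 4"
          then show "norm (h (of_real x + \<i> * of_real y) - of_real a) \<le> 9 * (u x - a)"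
            by (rule dist_limit_bot)
        qed
        then show "norm (Q x (pi / 4) - (Q 0 0 + pi / 4 * a)) \<le> pi / 4 * (9 * (u x - a))"
          by (simp only: real_norm_def)
      qed
    qed
    then show "((\<lambda>x. Q x (pi / 4)) \<longlongrightarrow> Q 0 0 + pi / 4 * a) at_bot"
      by (rule LIM_zero_cancel)
  qed
qed

section \<open>Speed along the centre line\<close>

text \<open>The conformal map of the disc onto the upper half strip that sends \<open>0\<close> to \<open>line x\<close>. The upper half
strip is a copy of the full strip at half the scale, and its centre line is \<open>Im z = pi / 4\<close>; the
derivative of the chart at \<open>0\<close> is \<open>1\<close>.\<close>

definition disc_chart :: "real \<Rightarrow> complex \<Rightarrow> complex" where
  "disc_chart x w = line x + disc_to_strip w / 2"

lemma disc_chart_image: "disc_chart x ` ball 0 1 = upper"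
proof (intro equalityI subsetI)
  fix z assume "z \<in> disc_chart x ` ball 0 1"
  then obtain w where "w \<in> ball 0 1" "z = disc_chart x w" by auto
  then show "z \<in> upper"
    using disc_to_strip_in_strip[of w] by (auto simp: disc_chart_def line_def strip_def abs_less_iff)
next
  fix z assume z: "z \<in> upper"
  have "Im (2 * (z - line x)) = 2 * Im z - pi / 2" by (simp add: line_def)
  moreover have "\<bar>2 * Im z - pi / 2\<bar> < pi / 2" using z by (simp only: mem_Collect_eq abs_less_iff) linarith
  ultimately have "2 * (z - line x) \<in> strip (pi / 2)" by (simp only: strip_def mem_Collect_eq)
  then obtain w where w: "w \<in> ball 0 1" "disc_to_strip w = 2 * (z - line x)"
    using disc_to_strip_image by (metis imageE)
  then have "disc_chart x w = z"
    by (simp only: disc_chart_def w(2)) (simp add: field_simps)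
  with w show "z \<in> disc_chart x ` ball 0 1" by blast
qed

lemma holomorphic_h_chart: "h \<circ> disc_chart x holomorphic_on ball 0 1"
proof (rule holomorphic_on_compose_gen[OF _ hol])
  show "disc_chart x holomorphic_on ball 0 1"
    unfolding disc_chart_def by (intro holomorphic_intros holomorphic_disc_to_strip) auto
  show "disc_chart x ` ball 0 1 \<subseteq> strip (pi / 2)"
    unfolding disc_chart_image by (rule upper_subset)
qed

lemma h_chart_pos: "Im ((h \<circ> disc_chart x) w) > 0" if "norm w < 1"
proof -
  have "disc_chart x w \<in> upper"
    using that unfolding disc_chart_image[of x, symmetric] by simp
  then show ?thesis using Im_h_pos by simp
qed

lemma h_chart_0: "(h \<circ> disc_chart x) 0 = h (line x)"
  by (simp add: disc_chart_def disc_to_strip_0)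

lemma deriv_h_chart: "deriv (h \<circ> disc_chart x) 0 = deriv h (line x)"
proof -
  have "(disc_chart x has_field_derivative 1) (at 0)"
    unfolding disc_chart_def[abs_def]
    by (auto intro!: derivative_eq_intros DERIV_disc_to_strip_0)
  moreover have "(h has_field_derivative deriv h (line x)) (at (disc_chart x 0))"
    using deriv_h[OF line_in_strip, of x] by (simp add: disc_chart_def disc_to_strip_0)
  ultimately show ?thesis
    using DERIV_chain DERIV_imp_deriv by fastforce
qed

text \<open>The chart has derivative \<open>1\<close> at \<open>0\<close>, so the Schwarz-Pick bound at the origin of the disc carries
over without a factor.\<close>

lemma speed_le: "norm (deriv h (line x)) \<le> 2 * Im (h (line x))"
  using schwarz_pick_deriv[OF holomorphic_h_chart h_chart_pos, of x] 
  by (simp only: deriv_h_chart h_chart_0)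

text \<open>The right-hand side does not depend on \<open>x\<close>: equality at one point of the line propagates to all
points.\<close>

lemma speed_eq_iff:
  "norm (deriv h (line x)) = 2 * Im (h (line x)) \<longleftrightarrow> h ` upper = {z. Im z > 0}"
proof -
  have img: "(h \<circ> disc_chart x) ` ball 0 1 = h ` upper"
    unfolding disc_chart_image[of x, symmetric] image_comp ..
  have "inj_on (disc_chart x) (ball 0 1)"
    using inj_on_disc_to_strip by (auto simp: inj_on_def disc_chart_def)
  then have "inj_on (h \<circ> disc_chart x) (ball 0 1)"
    by (rule comp_inj_on) (unfold disc_chart_image, rule inj_on_subset[OF inj upper_subset])
  then show ?thesis
    using schwarz_pick_equality_imp_onto[OF holomorphic_h_chart h_chart_pos, of x]
      schwarz_pick_equality_if_bij[OF holomorphic_h_chart h_chart_pos, of x]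
    unfolding deriv_h_chart h_chart_0 img by blast
qed

text \<open>The image of \<open>h\<close> always consists of the image of the upper half strip, its mirror image and the
interval from \<open>a\<close> to \<open>b\<close>, so only the image of the upper half strip can vary.\<close>

lemma onto_upper_iff_slit:
  "h ` upper = {z. Im z > 0} \<longleftrightarrow> h ` strip (pi / 2) = UNIV - of_real ` ({..a} \<union> {b..})"
proof
  assume up: "h ` upper = {z. Im z > 0}"
  show "h ` strip (pi / 2) = UNIV - of_real ` ({..a} \<union> {b..})"
  proof (intro equalityI subsetI)
    fix v assume "v \<in> h ` strip (pi / 2)"
    then obtain z where "z \<in> strip (pi / 2)" "v = h z" by blast
    then show "v \<in> UNIV - of_real ` ({..a} \<union> {b..})"
      using h_real_imp_between[of z] by force
  next
    fix v :: complex assume v: "v \<in> UNIV - of_real ` ({..a} \<union> {b..})"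
    consider "Im v > 0" | "Im v < 0" | "Im v = 0" by linarith
    then show "v \<in> h ` strip (pi / 2)"
    proof cases
      case 1
      then show ?thesis using up upper_subset by blast
    next
      case 2
      then have "cnj v \<in> h ` upper" unfolding up by simp
      then obtain z where z: "cnj v = h z" "z \<in> upper" by (rule imageE)
      then have "z \<in> strip (pi / 2)" using upper_subset by blast
      then have "h (cnj z) = cnj (h z)" by (rule h_cnj)
      then have "h (cnj z) = v" unfolding z(1)[symmetric] by simp
      moreover have "cnj z \<in> strip (pi / 2)" using z by (auto simp: strip_def)
      ultimately show ?thesis by blast
    next
      case 3
      then have eq: "v = of_real (Re v)" by (simp add: complex_eq_iff)
      then have "Re v \<in> {a<..<b}"
        using v by (metis DiffE UnCI atLeast_iff atMost_iff greaterThanLessThan_iff imageI linorder_not_less)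
      then obtain x where "Re v = u x" unfolding range_u[symmetric] by blast
      then have "h (of_real x) = v" using eq h_of_real by metis
      then show ?thesis by (metis imageI of_real_in_strip)
    qed
  qed
next
  assume slit: "h ` strip (pi / 2) = UNIV - of_real ` ({..a} \<union> {b..})"
  show "h ` upper = {z. Im z > 0}"
  proof (intro equalityI subsetI)
    fix v assume "v \<in> {z. Im z > 0}"
    then have v: "Im v > 0" by simp
    then have "v \<in> h ` strip (pi / 2)" unfolding slit by auto
    then obtain z where z: "z \<in> strip (pi / 2)" "v = h z" by blast
    have "Im z \<noteq> 0"
    proof
      assume "Im z = 0"
      then have "z = of_real (Re z)" by (simp add: complex_eq_iff)
      then have "v = of_real (u (Re z))" using z h_of_real by metis
      with v show False by simp
    qed
    moreover have "\<not> Im z < 0" using Im_h_neg[of z] v z by (auto simp: strip_def)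
    ultimately show "v \<in> h ` upper" using z by (auto simp: strip_def)
  qed (use Im_h_pos in auto)
qed

section \<open>Length of the image of the centre line\<close>

lemma speed_continuous: "continuous_on S (\<lambda>x. norm (deriv h (line x)))"
proof -
  have "continuous_on (strip (pi / 2)) (deriv h)"
    by (intro holomorphic_on_imp_continuous_on holomorphic_deriv hol open_strip)
  moreover have "line ` S \<subseteq> strip (pi / 2)" using line_in_strip by blast
  moreover have "continuous_on S line" unfolding line_def[abs_def] by (intro continuous_intros)
  ultimately have "continuous_on S (deriv h \<circ> line)"
    using continuous_on_compose continuous_on_subset by blast
  then show ?thesis by (simp add: o_def continuous_on_norm)
qed

text \<open>In the onto case \<open>2 V\<close> is an arc length function, so the length is its total increase. Otherwise
the true arc length function \<open>W\<close> grows strictly more slowly than \<open>2 V\<close> everywhere, and the amount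
\<open>\<delta>\<close> that it loses on the parameter interval from \<open>0\<close> to \<open>1\<close> is never regained.\<close>

lemma curve_length_line:
  "curve_length UNIV (\<lambda>x. h (line x)) \<le> ereal (pi / 2 * (b - a))"
  "curve_length UNIV (\<lambda>x. h (line x)) = ereal (pi / 2 * (b - a)) \<longleftrightarrow> h ` upper = {z. Im z > 0}"
proof -
  obtain V \<kappa> where V: "\<And>x. (V has_real_derivative Im (h (line x))) (at x)"
    and V_top: "(V \<longlongrightarrow> \<kappa> + pi / 4 * b) at_top" and V_bot: "(V \<longlongrightarrow> \<kappa> + pi / 4 * a) at_bot"
    by (rule flux_potential, rule that)
  have V_mono: "strict_mono V"
  proof (rule strict_monoI)
    show "V s < V t" if "s < t" for s t
      using DERIV_pos_imp_increasing[OF that] V Im_h_pos[OF line_in_upper] by blast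
  qed
  define \<phi> where "\<phi> x = 2 * V x" for x
  have \<phi>: "(\<phi> has_real_derivative 2 * Im (h (line x))) (at x)" for x
    unfolding \<phi>_def[abs_def] using V by (auto intro!: derivative_eq_intros)
  have \<phi>_less: "\<phi> t - \<phi> s \<le> pi / 2 * (b - a)" for s t
    using strict_mono_less_lim_top[OF V_mono V_top, of t] strict_mono_greater_lim_bot[OF V_mono V_bot, of s]
    by (simp add: \<phi>_def algebra_simps)
  have c: "((\<lambda>x. h (line x)) has_vector_derivative deriv h (line x)) (at x)" for x
    using h_vector_derivative_horizontal[of "pi / 4" x] by (simp add: line_def)
  show le: "curve_length UNIV (\<lambda>x. h (line x)) \<le> ereal (pi / 2 * (b - a))"
    using curve_length_le[OF c \<phi> speed_le \<phi>_less] .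
  show "curve_length UNIV (\<lambda>x. h (line x)) = ereal (pi / 2 * (b - a)) \<longleftrightarrow> h ` upper = {z. Im z > 0}"
  proof (cases "h ` upper = {z. Im z > 0}")
    case True
    have ge: "ereal (\<phi> t - \<phi> s) \<le> curve_length UNIV (\<lambda>x. h (line x))" if "s \<le> t" for s t
      using curve_length_ge[OF c _ that, of \<phi>] \<phi> True speed_eq_iff by simp
    have "((\<lambda>x. \<phi> x - \<phi> (- x)) \<longlongrightarrow> 2 * (\<kappa> + pi / 4 * b) - 2 * (\<kappa> + pi / 4 * a)) at_top"
      unfolding \<phi>_def
      by (intro tendsto_intros V_top filterlim_compose[OF V_bot] filterlim_uminus_at_bot_at_top)
    then have "((\<lambda>x. ereal (\<phi> x - \<phi> (- x))) \<longlongrightarrow> ereal (pi / 2 * (b - a))) at_top"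
      by (simp add: algebra_simps diff_divide_distrib)
    then have "ereal (pi / 2 * (b - a)) \<le> curve_length UNIV (\<lambda>x. h (line x))"
    proof (rule tendsto_upperbound)
      show "\<forall>\<^sub>F x in at_top. ereal (\<phi> x - \<phi> (- x)) \<le> curve_length UNIV (\<lambda>x. h (line x))"
        using eventually_ge_at_top[of 0] by eventually_elim (rule ge, simp)
    qed simp
    with le True show ?thesis by (simp add: antisym)
  next
    case False
    then have less: "norm (deriv h (line x)) < 2 * Im (h (line x))" for x
      using speed_le[of x] speed_eq_iff[of x] by (simp add: less_le)
    obtain W where W: "\<And>x. (W has_real_derivative norm (deriv h (line x))) (at x)"
      using continuous_has_antiderivative[OF speed_continuous] by blast
    have D: "strict_mono (\<lambda>x. \<phi> x - W x)"
    proof (rule strict_monoI)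
      fix s t :: real assume "s < t"
      then show "\<phi> s - W s < \<phi> t - W t"
      proof (rule DERIV_pos_imp_increasing)
        fix x
        show "\<exists>y. ((\<lambda>x. \<phi> x - W x) has_real_derivative y) (at x) \<and> y > 0"
          using DERIV_diff[OF \<phi>[of x] W[of x]] less[of x] by force
      qed
    qed
    define \<delta> where "\<delta> = (\<phi> 1 - W 1) - (\<phi> 0 - W 0)"
    have "\<delta> > 0" using strict_monoD[OF D, of 0 1] by (simp add: \<delta>_def)
    have W_mono: "W s \<le> W t" if "s \<le> t" for s t
      using DERIV_nonneg_imp_nondecreasing[OF that, of W] W norm_ge_zero by blast
    have W_le: "W t - W s \<le> pi / 2 * (b - a) - \<delta>" if "s \<le> t" for s t
    proof -
      \<comment> \<open>Enlarge the parameter interval so that it contains \<open>0\<close> and \<open>1\<close>.\<close>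
      have "\<phi> 1 - W 1 \<le> \<phi> (max t 1) - W (max t 1)" "\<phi> (min s 0) - W (min s 0) \<le> \<phi> 0 - W 0"
        using strict_monoD[OF D] strict_mono_leD[OF D] by simp_all
      moreover have "W t \<le> W (max t 1)" "W (min s 0) \<le> W s"
        by (simp_all add: W_mono)
      ultimately show ?thesis
        using \<phi>_less[of "max t 1" "min s 0"] by (simp add: \<delta>_def)
    qed
    have "curve_length UNIV (\<lambda>x. h (line x)) \<le> ereal (pi / 2 * (b - a) - \<delta>)"
      using curve_length_le[OF c W order_refl W_le] .
    also have "\<dots> < ereal (pi / 2 * (b - a))" using \<open>\<delta> > 0\<close> by simp
    finally show ?thesis using False by simp
  qed
qed

text \<open>The inverse of \<open>h\<close> is holomorphic on the open image of the strip, so its real part is a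
continuous inverse of the parametrization by the line.\<close>

lemma homeomorphism_line:
  "\<exists>c'. homeomorphism UNIV (h ` {z. Im z = pi / 4}) (\<lambda>x. h (line x)) c'"
proof -
  obtain k where k: "k holomorphic_on h ` strip (pi / 2)" "\<And>z. z \<in> strip (pi / 2) \<Longrightarrow> k (h z) = z"
    using holomorphic_has_inverse[OF hol open_strip inj] by metis
  have range_line: "range line = {z. Im z = pi / 4}"
    by (auto simp: line_def complex_eq_iff image_iff)
  have "homeomorphism UNIV (h ` {z. Im z = pi / 4}) (\<lambda>x. h (line x)) (\<lambda>v. Re (k v))"
  proof (rule homeomorphismI)
    show "continuous_on UNIV (\<lambda>x. h (line x))"
      using h_vector_derivative_horizontal[of "pi / 4"]
      by (intro continuous_at_imp_continuous_on ballI has_vector_derivative_continuous)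
        (simp add: line_def)
    have "h ` {z. Im z = pi / 4} \<subseteq> h ` strip (pi / 2)"
      unfolding range_line[symmetric] using line_in_strip by blast
    then show "continuous_on (h ` {z. Im z = pi / 4}) (\<lambda>v. Re (k v))"
      using k(1) by (intro continuous_intros)
        (meson holomorphic_on_imp_continuous_on continuous_on_subset)
    show "(\<lambda>x. h (line x)) ` UNIV \<subseteq> h ` {z. Im z = pi / 4}"
      unfolding range_line[symmetric] by auto
    show "Re (k (h (line x))) = x" for x
      using k(2)[OF line_in_strip, of x] by (simp add: line_def)
    show "h (line (Re (k v))) = v" if "v \<in> h ` {z. Im z = pi / 4}" for v
    proof -
      obtain x where x: "v = h (line x)" using \<open>v \<in> _\<close> unfolding range_line[symmetric] by blast
      have "Re (k v) = x" using k(2)[OF line_in_strip, of x] by (simp add: x line_def)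
      with x show ?thesis by simp
    qed
  qed auto
  then show ?thesis by blast
qed

end

section \<open>Return to the disc\<close>

text \<open>Conjugating the Taylor series of \<open>g\<close> at \<open>z\<close> term by term gives its Taylor series at \<open>cnj z\<close>.\<close>

lemma cnj_symmetric_if_real_coeffs:
  assumes hol: "g holomorphic_on ball 0 r" and real: "\<And>n. (deriv ^^ n) g 0 / fact n \<in> \<real>"
    and z: "z \<in> ball 0 r"
  shows "g (cnj z) = cnj (g z)"
proof -
  have "(\<lambda>n. cnj ((deriv ^^ n) g 0 / fact n * (z - 0) ^ n)) sums cnj (g z)"
    unfolding sums_cnj by (rule holomorphic_power_series[OF hol z])
  moreover have "cnj ((deriv ^^ n) g 0 / fact n * (z - 0) ^ n) = (deriv ^^ n) g 0 / fact n * (cnj z - 0) ^ n" for n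
    using real[of n] unfolding Reals_cnj_iff
    by (simp only: complex_cnj_mult complex_cnj_power complex_cnj_diff complex_cnj_zero)
  ultimately have "(\<lambda>n. (deriv ^^ n) g 0 / fact n * (cnj z - 0) ^ n) sums cnj (g z)"
    by (simp only:)
  moreover have "(\<lambda>n. (deriv ^^ n) g 0 / fact n * (cnj z - 0) ^ n) sums g (cnj z)"
    using z by (intro holomorphic_power_series[OF hol]) simp
  ultimately show ?thesis using sums_unique2 by blast
qed

lemma real_univalent_strip_compose:
  assumes g: "totally_real_univalent g" and pos: "Re (deriv g 0) > 0"
    and bot: "((\<lambda>x. g (complex_of_real x)) \<longlongrightarrow> complex_of_real a) (at_right (-1))"
    and top: "((\<lambda>x. g (complex_of_real x)) \<longlongrightarrow> complex_of_real b) (at_left 1)"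
  shows "real_univalent_strip (g \<circ> strip_to_disc) a b"
proof
  have hol: "g holomorphic_on ball 0 1" and inj: "inj_on g (ball 0 1)"
    and real: "(deriv ^^ n) g 0 / fact n \<in> \<real>" for n
    using g by (auto simp: totally_real_univalent_def)
  show "g \<circ> strip_to_disc holomorphic_on strip (pi / 2)"
    by (rule holomorphic_on_compose_gen[OF holomorphic_strip_to_disc hol])
       (simp add: strip_to_disc_image)
  show "inj_on (g \<circ> strip_to_disc) (strip (pi / 2))"
    using inj by (intro comp_inj_on inj_on_strip_to_disc) (simp add: strip_to_disc_image)
  show "(g \<circ> strip_to_disc) (cnj z) = cnj ((g \<circ> strip_to_disc) z)" if "z \<in> strip (pi / 2)" for z
    using cnj_symmetric_if_real_coeffs[OF hol real strip_to_disc_in_disc[OF that]]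
    by (simp add: strip_to_disc_cnj)
  have "(g has_field_derivative deriv g 0) (at (strip_to_disc 0))"
    using holomorphic_derivI[OF hol open_ball, of 0] by (simp add: strip_to_disc_0)
  from DERIV_imp_deriv[OF DERIV_chain[OF this DERIV_strip_to_disc_0]]
  have deriv_eq: "deriv (g \<circ> strip_to_disc) 0 = deriv g 0 * (1 / 2)" .
  show "Re (deriv (g \<circ> strip_to_disc) 0) > 0"
    unfolding deriv_eq using pos by simp
  have "filterlim (\<lambda>x::real. (exp x - 1) / (exp x + 1)) (at_left 1) at_top"
    by real_asymp
  from filterlim_compose[OF top this]
  show "((\<lambda>x. (g \<circ> strip_to_disc) (of_real x)) \<longlongrightarrow> of_real b) at_top"
    by (simp only: o_def strip_to_disc_of_real)
  have "filterlim (\<lambda>x::real. (exp x - 1) / (exp x + 1)) (at_right (-1)) at_bot"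
    by real_asymp
  from filterlim_compose[OF bot this]
  show "((\<lambda>x. (g \<circ> strip_to_disc) (of_real x)) \<longlongrightarrow> of_real a) at_bot"
    by (simp only: o_def strip_to_disc_of_real)
qed

theorem proposition3:
  fixes g :: "complex \<Rightarrow> complex" and a b :: real
  assumes "totally_real_univalent g"
    and "Re (deriv g 0) > 0"
    and "((\<lambda>x. g (complex_of_real x)) \<longlongrightarrow> complex_of_real a) (at_right (-1))"
    and "((\<lambda>x. g (complex_of_real x)) \<longlongrightarrow> complex_of_real b) (at_left 1)"
  shows "(\<exists>\<gamma>. open_arc_param \<gamma> (g ` Gamma_arc)) \<and>
    (\<forall>\<gamma>. open_arc_param \<gamma> (g ` Gamma_arc) \<longrightarrow>
       curve_length {0<..<1} \<gamma> \<le> ereal (pi / 2 * (b - a)) \<and>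
       (curve_length {0<..<1} \<gamma> = ereal (pi / 2 * (b - a)) \<longleftrightarrow>
        g ` ball 0 1 = UNIV - complex_of_real ` ({..a} \<union> {b..})))"
proof -
  define h where "h = g \<circ> strip_to_disc"
  interpret real_univalent_strip h a b
    unfolding h_def using assms by (rule real_univalent_strip_compose)
  define c where "c x = h (line x)" for x
  have disc: "g ` ball 0 1 = h ` strip (pi / 2)"
    by (simp only: h_def image_comp[symmetric] strip_to_disc_image)
  have arc: "g ` Gamma_arc = h ` {z. Im z = pi / 4}"
    by (simp only: h_def image_comp[symmetric] Gamma_arc_eq)
  obtain c' where c': "homeomorphism UNIV (g ` Gamma_arc) c c'"
    unfolding arc c_def using homeomorphism_line by blast
  show ?thesis
  proof (intro conjI allI impI)
    have "{0<..<1::real} homeomorphic (UNIV :: real set)"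
      by (rule homeomorphic_open_interval_UNIV) simp
    then obtain \<psi> \<psi>' where "homeomorphism {0<..<1::real} (UNIV :: real set) \<psi> \<psi>'"
      unfolding homeomorphic_def by blast
    from homeomorphism_compose[OF this c']
    show "\<exists>\<gamma>. open_arc_param \<gamma> (g ` Gamma_arc)"
      unfolding open_arc_param_def by blast
  next
    fix \<gamma> assume "open_arc_param \<gamma> (g ` Gamma_arc)"
    then obtain \<gamma>' where "homeomorphism {0<..<1} (g ` Gamma_arc) \<gamma> \<gamma>'"
      unfolding open_arc_param_def by blast
    then have eq: "curve_length {0<..<1} \<gamma> = curve_length UNIV c"
      using c' by (intro curve_length_homeomorphism) (auto simp: is_interval_convex_1)
    show "curve_length {0<..<1} \<gamma> \<le> ereal (pi / 2 * (b - a))"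
      unfolding eq c_def by (rule curve_length_line)
    show "curve_length {0<..<1} \<gamma> = ereal (pi / 2 * (b - a)) \<longleftrightarrow>
        g ` ball 0 1 = UNIV - complex_of_real ` ({..a} \<union> {b..})"
      unfolding eq c_def disc onto_upper_iff_slit[symmetric] by (rule curve_length_line)
  qed
qed

end
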